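(* Let $d\geq 14$ be an integer with $d\neq 15$ and $d\neq 17$. Then every $d$-regular graph $G$ can be decomposed into two graphs each of which fulfills the 1--2--3 Conjecture.
   Context: All graphs are finite and simple. A decomposition of a graph $G=(V,E)$ into $k$ graphs is a partition $E=E_1\cup\dots\cup E_k$ (parts may be empty), the graphs being $G_i=(V,E_i)$. For an edge-weighting $\omega:E\to\{1,2,3\}$ of a graph $G=(V,E)$, the sum at a vertex $v$ is $s_\omega(v)=\sum_{e\ni v}\omega(e)$. A graph $G$ fulfills the 1--2--3 Conjecture if there exists $\omega:E\to\{1,2,3\}$ with $s_\omega(u)\neq s_\omega(v)$ for every edge $uv\in E$ (an edgeless graph fulfills it trivially). *)

theory Defs
  imports Main "HOL-Library.Disjoint_Sets"
begin

text \<open>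
  Undirected edges are two-element sets of vertices, so that an edge weighting is a function on
  edges and an edge partition is a family of subsets of \<open>E\<close>.
\<close>

locale simple_graph =
  fixes V :: "'a set" and E :: "'a set set"
  assumes finite_verts: "finite V"
    and edge_subset: "e \<in> E \<Longrightarrow> e \<subseteq> V"
    and edge_card: "e \<in> E \<Longrightarrow> card e = 2"

definition incident_edges :: "'a set set \<Rightarrow> 'a \<Rightarrow> 'a set set" where
  "incident_edges E v = {e \<in> E. v \<in> e}"

definition regular_graph :: "nat \<Rightarrow> 'a set \<Rightarrow> 'a set set \<Rightarrow> bool" where
  "regular_graph d V E \<longleftrightarrow> simple_graph V E \<and> (\<forall>v\<in>V. card (incident_edges E v) = d)"

text \<open>The parts are indexed by \<open>{..<k}\<close>, each giving the graph on all of \<open>V\<close>; parts may be empty.\<close>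

definition graph_decomposition :: "'a set set \<Rightarrow> nat \<Rightarrow> (nat \<Rightarrow> 'a set set) \<Rightarrow> bool" where
  "graph_decomposition E k F \<longleftrightarrow> disjoint_family_on F {..<k} \<and> (\<Union>i<k. F i) = E"

definition weighted_sum :: "'a set set \<Rightarrow> ('a set \<Rightarrow> nat) \<Rightarrow> 'a \<Rightarrow> nat" where
  "weighted_sum E w v = (\<Sum>e\<in>incident_edges E v. w e)"

text \<open>Weights outside \<open>E\<close> are irrelevant, as \<open>weighted_sum E w\<close> only involves edges in \<open>E\<close>.\<close>

definition fulfills_123 :: "'a set \<Rightarrow> 'a set set \<Rightarrow> bool" where
  "fulfills_123 V E \<longleftrightarrow>
     (\<exists>w :: 'a set \<Rightarrow> nat. (\<forall>e\<in>E. w e \<in> {1, 2, 3}) \<and>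
        (\<forall>u\<in>V. \<forall>v\<in>V. {u, v} \<in> E \<longrightarrow> weighted_sum E w u \<noteq> weighted_sum E w v))"

end

theory Submission
  imports Defs Complex_Main
begin

text \<open>
  By the Lovasz Local Lemma there is a bipartition \<open>V = R \<union> S\<close> in which every vertex has more than
  \<open>c\<close> neighbours in each part, where \<open>c = 1\<close> for even \<open>d\<close> and \<open>c = 2\<close> for odd \<open>d\<close>; this is where the
  restrictions on \<open>d\<close> come from. Orient the edges between \<open>R\<close> and \<open>S\<close> so that in- and
  outdegrees differ by at most one. For \<open>U = R, S\<close> let one graph consist of the edges inside \<open>U\<close> and
  the arcs leaving \<open>U\<close>. Give weight 2 to these arcs, except for one private arc of each vertex
  of \<open>U\<close>, whose weight 1 or 2 simulates the vertex weight in Kalkowski's total weighting of \<open>G[U]\<close>.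
  Then neighbours inside \<open>U\<close> get distinct sums, all sums in \<open>U\<close> are at least \<open>d - 1\<close>, and all sums
  outside \<open>U\<close> are at most twice the indegree, hence at most \<open>d - 2\<close>.
\<close>

section \<open>The Lovasz Local Lemma\<close>

text \<open>For a uniformly random subset \<open>R\<close> of \<open>V\<close>, the traces on
  \<open>A\<close> and \<open>V - A\<close> are independent: \<open>R\<close> corresponds to the
  pair of them, so counts multiply.\<close>

lemma card_Pow_split:
  assumes "finite V" "A \<subseteq> V"
  shows "card {R \<in> Pow V. P (R \<inter> A) \<and> Q (R - A)}
    = card {X \<in> Pow A. P X} * card {Y \<in> Pow (V - A). Q Y}"
proof -
  have "bij_betw (\<lambda>R. (R \<inter> A, R - A)) {R \<in> Pow V. P (R \<inter> A) \<and> Q (R - A)}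
      ({X \<in> Pow A. P X} \<times> {Y \<in> Pow (V - A). Q Y})"
  proof (rule bij_betw_byWitness[where f' = "\<lambda>(X, Y). X \<union> Y"])
    show "\<forall>y\<in>{X \<in> Pow A. P X} \<times> {Y \<in> Pow (V - A). Q Y}.
        (((case y of (X, Y) \<Rightarrow> X \<union> Y) \<inter> A), (case y of (X, Y) \<Rightarrow> X \<union> Y) - A) = y"
      by (auto split: prod.splits)
    show "(\<lambda>(X, Y). X \<union> Y) ` ({X \<in> Pow A. P X} \<times> {Y \<in> Pow (V - A). Q Y})
        \<subseteq> {R \<in> Pow V. P (R \<inter> A) \<and> Q (R - A)}"
    proof
      fix R assume "R \<in> (\<lambda>(X, Y). X \<union> Y) ` ({X \<in> Pow A. P X} \<times> {Y \<in> Pow (V - A). Q Y})"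
      then obtain X Y where R: "R = X \<union> Y" "X \<subseteq> A" "P X" "Y \<subseteq> V - A" "Q Y" by auto
      then have "R \<inter> A = X" "R - A = Y" by auto
      then show "R \<in> {R \<in> Pow V. P (R \<inter> A) \<and> Q (R - A)}" using R assms(2) by auto
    qed
  qed auto
  from bij_betw_same_card[OF this] show ?thesis
    by (simp only: card_cartesian_product)
qed

text \<open>The product rule for independent events, multiplied by the square of
  \<open>2 ^ card V\<close> so that it speaks of cardinalities only.\<close>

lemma card_Pow_independent:
  assumes V: "finite V" and A: "A \<subseteq> V"
    and P: "\<And>R. R \<subseteq> V \<Longrightarrow> P (R \<inter> A) = P R"
    and Q: "\<And>R. R \<subseteq> V \<Longrightarrow> Q (R - A) = Q R"
  shows "card {R \<in> Pow V. P R \<and> Q R} * 2 ^ card V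
    = card {R \<in> Pow V. P R} * card {R \<in> Pow V. Q R}"
proof -
  have fin: "finite A" using V A by (rule finite_subset[rotated])
  have PQ: "{R \<in> Pow V. P R \<and> Q R} = {R \<in> Pow V. P (R \<inter> A) \<and> Q (R - A)}"
    using P Q by auto
  have Pe: "{R \<in> Pow V. P R} = {R \<in> Pow V. P (R \<inter> A) \<and> True}"
    using P by auto
  have Qe: "{R \<in> Pow V. Q R} = {R \<in> Pow V. True \<and> Q (R - A)}"
    using Q by auto
  have pow: "(2::nat) ^ card V = 2 ^ card A * 2 ^ card (V - A)"
    using V A fin by (simp add: card_Diff_subset card_mono flip: power_add)
  show ?thesis
    unfolding PQ Pe Qe card_Pow_split[OF V A, of P Q] card_Pow_split[OF V A, of P "\<lambda>_. True"]
      card_Pow_split[OF V A, of "\<lambda>_. True" Q] pow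
    using V fin card_Pow[of A] card_Pow[of "V - A"] by (simp add: Pow_def)
qed

text \<open>Probability is counting over the subsets \<open>R\<close> of \<open>V\<close>. As
  \<open>bad i\<close> depends only on the trace of \<open>R\<close> on \<open>N i\<close>, it is
  independent of all events whose sets \<open>N j\<close> avoid \<open>N i\<close>. Strong induction
  on \<open>card S\<close> bounds by \<open>x\<close> the probability of \<open>bad i\<close> under
  the condition that no event in \<open>S\<close> occurs.\<close>

lemma lovasz_local_lemma:
  fixes bad :: "'i \<Rightarrow> 'v set \<Rightarrow> bool" and N :: "'i \<Rightarrow> 'v set" and p x :: real
  assumes V: "finite V" and I: "finite I"
    and N: "\<And>i. i \<in> I \<Longrightarrow> N i \<subseteq> V"
    and loc: "\<And>i R. i \<in> I \<Longrightarrow> R \<subseteq> V \<Longrightarrow> bad i (R \<inter> N i) = bad i R"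
    and deg: "\<And>i. i \<in> I \<Longrightarrow> card {j \<in> I. j \<noteq> i \<and> N j \<inter> N i \<noteq> {}} \<le> D"
    and prob: "\<And>i. i \<in> I \<Longrightarrow> real (card {R \<in> Pow V. bad i R}) \<le> p * 2 ^ card V"
    and x: "0 \<le> x" "x < 1" and p: "p \<le> x * (1 - x) ^ D"
  shows "\<exists>R\<subseteq>V. \<forall>i\<in>I. \<not> bad i R"
proof -
  \<comment> \<open>The inequality \<open>\<nu> i S \<le> x * \<mu> S\<close> replaces the bound on
    a conditional probability, so positivity of \<open>\<mu> S\<close> need not be carried through
    the induction.\<close>
  define \<mu> :: "'i set \<Rightarrow> real" where "\<mu> S = card {R \<in> Pow V. \<forall>j\<in>S. \<not> bad j R}" for S
  define \<nu> :: "'i \<Rightarrow> 'i set \<Rightarrow> real"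
    where "\<nu> i S = card {R \<in> Pow V. bad i R \<and> (\<forall>j\<in>S. \<not> bad j R)}" for i S
  have \<mu>_insert: "\<mu> (insert i S) = \<mu> S - \<nu> i S" for i S
  proof -
    have "{R \<in> Pow V. \<forall>j\<in>S. \<not> bad j R} = {R \<in> Pow V. \<forall>j\<in>insert i S. \<not> bad j R}
        \<union> {R \<in> Pow V. bad i R \<and> (\<forall>j\<in>S. \<not> bad j R)}" by auto
    moreover have "{R \<in> Pow V. \<forall>j\<in>insert i S. \<not> bad j R}
        \<inter> {R \<in> Pow V. bad i R \<and> (\<forall>j\<in>S. \<not> bad j R)} = {}" by auto
    ultimately have "card {R \<in> Pow V. \<forall>j\<in>S. \<not> bad j R} = card {R \<in> Pow V. \<forall>j\<in>insert i S. \<not> bad j R}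
        + card {R \<in> Pow V. bad i R \<and> (\<forall>j\<in>S. \<not> bad j R)}"
      using V by (simp add: card_Un_disjoint)
    then show ?thesis by (simp add: \<mu>_def \<nu>_def)
  qed
  \<comment> \<open>Chain rule: each index added to \<open>S\<close> keeps at least the fraction
    \<open>1 - x\<close> of the count. The assumption concerns only proper subsets \<open>T\<close>
    of \<open>S' \<union> S\<close>, so the induction hypothesis of \<open>main\<close> can supply
    it.\<close>
  have grow: "(1 - x) ^ card S' * \<mu> S \<le> \<mu> (S' \<union> S)"
    if "finite S'" "\<And>j T. j \<in> S' \<Longrightarrow> S \<subseteq> T \<Longrightarrow> T \<subset> S' \<union> S \<Longrightarrow> j \<notin> T \<Longrightarrow> \<nu> j T \<le> x * \<mu> T"
      "S' \<inter> S = {}" for S' S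
    using that
  proof (induction S' rule: finite_induct)
    case empty
    then show ?case by simp
  next
    case (insert i S')
    have "(1 - x) ^ card S' * \<mu> S \<le> \<mu> (S' \<union> S)"
      using insert.prems insert.hyps by (intro insert.IH) auto
    moreover have "\<nu> i (S' \<union> S) \<le> x * \<mu> (S' \<union> S)"
      using insert.prems(2) insert.hyps by (intro insert.prems(1)) auto
    then have "(1 - x) * \<mu> (S' \<union> S) \<le> \<mu> (insert i (S' \<union> S))"
      by (simp add: \<mu>_insert algebra_simps)
    ultimately have "(1 - x) * ((1 - x) ^ card S' * \<mu> S) \<le> \<mu> (insert i (S' \<union> S))"
      using x mult_left_mono[of _ _ "1 - x"] by (smt (verit))
    then show ?case using insert.hyps by simp
  qed
  have main: "\<nu> i S \<le> x * \<mu> S" if "S \<subseteq> I" "i \<in> I" "i \<notin> S" for i S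
    using that
  proof (induction "card S" arbitrary: S i rule: less_induct)
    case less
    have fS: "finite S" using less.prems I finite_subset by blast
    \<comment> \<open>The events in \<open>S2\<close> are independent of \<open>bad i\<close>; the
      at most \<open>D\<close> events in \<open>S1\<close> are dropped from the numerator and cost a
      factor \<open>(1 - x) ^ card S1\<close> in the denominator.\<close>
    define S1 where "S1 = {j \<in> S. N j \<inter> N i \<noteq> {}}"
    define S2 where "S2 = S - S1"
    have S: "S = S1 \<union> S2" "S1 \<inter> S2 = {}" "S1 \<subseteq> S" "S2 \<subseteq> S"
      by (auto simp: S1_def S2_def)
    have "\<nu> i S2 * 2 ^ card V = card {R \<in> Pow V. bad i R} * \<mu> S2"
    proof -
      have "card {R \<in> Pow V. bad i R \<and> (\<forall>j\<in>S2. \<not> bad j R)} * 2 ^ card V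
          = card {R \<in> Pow V. bad i R} * card {R \<in> Pow V. \<forall>j\<in>S2. \<not> bad j R}"
      proof (rule card_Pow_independent[where A = "N i", OF V N[OF less.prems(2)]])
        show "bad i (R \<inter> N i) = bad i R" if "R \<subseteq> V" for R
          using loc less.prems(2) that .
        fix R assume R: "R \<subseteq> V"
        have "bad j (R - N i) = bad j R" if "j \<in> S2" for j
        proof -
          have j: "j \<in> I" "N j \<inter> N i = {}"
            using that less.prems(1) by (auto simp: S2_def S1_def)
          then have "(R - N i) \<inter> N j = R \<inter> N j" by auto
          then show ?thesis using loc[OF j(1), of R] loc[OF j(1), of "R - N i"] R by auto
        qed
        then show "(\<forall>j\<in>S2. \<not> bad j (R - N i)) = (\<forall>j\<in>S2. \<not> bad j R)" by auto
      qed
      then have "real (card {R \<in> Pow V. bad i R \<and> (\<forall>j\<in>S2. \<not> bad j R)} * 2 ^ card V)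
          = real (card {R \<in> Pow V. bad i R} * card {R \<in> Pow V. \<forall>j\<in>S2. \<not> bad j R})"
        by (simp only:)
      then show ?thesis by (simp only: \<nu>_def \<mu>_def of_nat_mult of_nat_power of_nat_numeral)
    qed
    also have "\<dots> \<le> p * 2 ^ card V * \<mu> S2"
      using prob[OF less.prems(2)] by (intro mult_right_mono) (auto simp: \<mu>_def)
    finally have "\<nu> i S2 \<le> p * \<mu> S2" by simp
    moreover have "\<nu> i S \<le> \<nu> i S2"
      unfolding \<nu>_def using S(4) V by (auto intro!: card_mono)
    ultimately have "\<nu> i S \<le> p * \<mu> S2" by simp
    also have "\<dots> \<le> x * (1 - x) ^ D * \<mu> S2"
      using p by (intro mult_right_mono) (auto simp: \<mu>_def)
    also have "\<dots> \<le> x * ((1 - x) ^ card S1 * \<mu> S2)"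
    proof -
      have "S1 \<subseteq> {j \<in> I. j \<noteq> i \<and> N j \<inter> N i \<noteq> {}}"
        using less.prems by (auto simp: S1_def)
      then have "card S1 \<le> card {j \<in> I. j \<noteq> i \<and> N j \<inter> N i \<noteq> {}}"
        using I by (intro card_mono) auto
      also have "\<dots> \<le> D" using deg less.prems(2) .
      finally have "(1 - x) ^ D \<le> (1 - x) ^ card S1"
        using x by (intro power_decreasing) auto
      then have "(1 - x) ^ D * \<mu> S2 \<le> (1 - x) ^ card S1 * \<mu> S2"
        by (intro mult_right_mono) (auto simp: \<mu>_def)
      then show ?thesis using x by (simp add: mult.assoc mult_left_mono)
    qed
    also have "\<dots> \<le> x * \<mu> (S1 \<union> S2)"
    proof (intro mult_left_mono grow)
      show "finite S1" using fS S(3) finite_subset by blast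
      fix j T assume "j \<in> S1" "T \<subset> S1 \<union> S2" "j \<notin> T"
      then show "\<nu> j T \<le> x * \<mu> T"
        using less.prems S fS by (intro less.hyps psubset_card_mono) auto
    qed (use x S in auto)
    finally show ?case using S(1) by simp
  qed
  have "(1 - x) ^ card I * \<mu> {} \<le> \<mu> (I \<union> {})"
    using main by (intro grow I) auto
  moreover have "\<mu> {} > 0" using card_Pow[OF V] by (simp add: \<mu>_def Pow_def)
  ultimately have "\<mu> I > 0"
    using x by (smt (verit) zero_less_power mult_pos_pos sup_bot_right)
  then have "0 < card {R \<in> Pow V. \<forall>j\<in>I. \<not> bad j R}" by (simp add: \<mu>_def)
  then have "{R \<in> Pow V. \<forall>j\<in>I. \<not> bad j R} \<noteq> {}" by (metis card.empty less_irrefl)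
  then show ?thesis by blast
qed

section \<open>Balanced orientations\<close>

definition excess :: "('a \<times> 'a) set \<Rightarrow> 'a \<Rightarrow> int" where
  "excess D v = int (card (D `` {v})) - int (card (D\<inverse> `` {v}))"

text \<open>The tail \<open>u\<close> loses an out-neighbour and gains an in-neighbour, and
  \<open>v\<close> the other way round. Without opposite arcs in \<open>D\<close> the reversed arc
  is new, so each of these degrees changes by exactly one.\<close>

lemma excess_reverse_arc:
  assumes D: "finite D" "D \<inter> D\<inverse> = {}" and uv: "(u, v) \<in> D"
  defines "D' \<equiv> insert (v, u) (D - {(u, v)})"
  shows "excess D' x = excess D x - (if x = u then 2 else 0) + (if x = v then 2 else 0)"
proof -
  have ne: "u \<noteq> v" "(v, u) \<notin> D" using D(2) uv by auto
  have fin: "finite (D `` {y})" "finite (D\<inverse> `` {y})" for y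
    using D(1) by (auto intro: finite_Image)
  have out: "D' `` {u} = D `` {u} - {v}" "D' `` {v} = insert u (D `` {v})"
    and inn: "D'\<inverse> `` {v} = D\<inverse> `` {v} - {u}" "D'\<inverse> `` {u} = insert v (D\<inverse> `` {u})"
    using ne by (auto simp: D'_def)
  have other: "D' `` {x} = D `` {x}" "D'\<inverse> `` {x} = D\<inverse> `` {x}" if "x \<noteq> u" "x \<noteq> v"
    using that by (auto simp: D'_def)
  have pos: "card (D `` {u}) > 0" "card (D\<inverse> `` {v}) > 0"
    using uv fin by (auto simp: card_gt_0_iff)
  consider "x = u" | "x = v" | "x \<noteq> u" "x \<noteq> v" by blast
  then show ?thesis
  proof cases
    case 1
    then show ?thesis using ne fin pos out inn uv
      by (auto simp: excess_def card_Diff_singleton_if)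
  next
    case 2
    then show ?thesis using ne fin pos out inn uv
      by (auto simp: excess_def card_Diff_singleton_if)
  next
    case 3
    then show ?thesis using other by (simp add: excess_def)
  qed
qed

lemma excess_converse: "excess (D\<inverse>) v = - excess D v"
  by (simp add: excess_def)

lemma rtrancl_imp_distinct_path:
  assumes "(u, v) \<in> D\<^sup>*"
  shows "\<exists>p. hd (p @ [v]) = u \<and> distinct (p @ [v]) \<and> successively (\<lambda>x y. (x, y) \<in> D) (p @ [v])"
  using assms
proof (induction rule: converse_rtrancl_induct)
  case base
  show ?case by (intro exI[of _ "[]"]) simp
next
  case (step u w)
  then obtain p where p: "hd (p @ [v]) = w" "distinct (p @ [v])"
    "successively (\<lambda>x y. (x, y) \<in> D) (p @ [v])" by blast
  \<comment> \<open>If \<open>u\<close> already lies on the path, prepending it would create a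
    repetition; instead the path is cut back to start at that occurrence.\<close>
  show ?case
  proof (cases "u \<in> set (p @ [v])")
    case True
    show ?thesis
    proof (cases "u = v")
      case True
      then show ?thesis by (intro exI[of _ "[]"]) simp
    next
      case False
      then have "u \<in> set p" using True by simp
      then obtain q r where q: "p = q @ u # r" by (meson split_list)
      show ?thesis
        using p by (intro exI[of _ "u # r"]) (auto simp: q successively_append_iff)
    qed
  next
    case False
    then show ?thesis
      using p step.hyps(1)
      by (intro exI[of _ "u # p"]) (cases p, auto)
  qed
qed

text \<open>An undirected graph is encoded as a symmetric relation \<open>A\<close> containing both
  directions of each edge; an orientation keeps one of them.\<close>

definition orients :: "('a \<times> 'a) set \<Rightarrow> ('a \<times> 'a) set \<Rightarrow> bool" where
  "orients A D \<longleftrightarrow> D \<inter> D\<inverse> = {} \<and> D \<union> D\<inverse> = A"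

text \<open>Reversing the arcs one after another, every inner vertex first gains 2 and then loses 2,
  so only the excess of the two ends changes.\<close>

lemma orients_reverse_path:
  assumes "finite A" "orients A D" "distinct (u # p)" "successively (\<lambda>x y. (x, y) \<in> D) (u # p)" "p \<noteq> []"
  shows "\<exists>D'. orients A D' \<and>
    (\<forall>x. excess D' x = excess D x - (if x = u then 2 else 0) + (if x = last p then 2 else 0))"
  using assms(2-)
proof (induction p arbitrary: u D)
  case Nil
  then show ?case by simp
next
  case (Cons v p)
  have uv: "(u, v) \<in> D" using Cons.prems(3) by simp
  have D: "finite D" "D \<inter> D\<inverse> = {}"
    using Cons.prems(1) assms(1) finite_subset by (auto simp: orients_def)
  define D1 where "D1 = insert (v, u) (D - {(u, v)})"
  have o1: "orients A D1" using Cons.prems(1) uv by (auto simp: orients_def D1_def)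
  have e1: "excess D1 x = excess D x - (if x = u then 2 else 0) + (if x = v then 2 else 0)" for x
    unfolding D1_def by (rule excess_reverse_arc[OF D uv])
  show ?case
  proof (cases "p = []")
    case True
    then show ?thesis using o1 e1 by auto
  next
    case False
    \<comment> \<open>The only arc missing from \<open>D1\<close> leaves \<open>u\<close>, and by
      distinctness \<open>u\<close> is not on the rest of the path.\<close>
    have "successively (\<lambda>x y. (x, y) \<in> D1) (v # p)"
    proof (rule successively_mono)
      show "successively (\<lambda>x y. (x, y) \<in> D) (v # p)" using Cons.prems(3) by simp
      fix x y assume "x \<in> set (v # p)" "y \<in> set (v # p)" "(x, y) \<in> D"
      then show "(x, y) \<in> D1" using Cons.prems(2) unfolding D1_def by auto
    qed
    then obtain D' where "orients A D'"
      "\<forall>x. excess D' x = excess D1 x - (if x = v then 2 else 0) + (if x = last p then 2 else 0)"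
      using Cons.IH[OF o1 _ _ False] Cons.prems(2) by auto
    then show ?thesis
      using e1 False by (intro exI[of _ D']) auto
  qed
qed

lemma exists_orientation:
  assumes "sym A" "irrefl A"
  shows "\<exists>D. orients A D"
proof -
  \<comment> \<open>Every edge is directed along a linear order of the vertices.\<close>
  obtain r :: "'a rel" where r: "well_order_on UNIV r" using well_order_on by blast
  then have r: "(x, y) \<in> r \<longleftrightarrow> (y, x) \<notin> r" if "x \<noteq> y" for x y
    using that by (auto simp: well_order_on_def linear_order_on_def partial_order_on_def
        total_on_def antisym_def)
  have "(y, x) \<in> A \<and> ((x, y) \<in> r \<longleftrightarrow> (y, x) \<notin> r)" if "(x, y) \<in> A" for x y
    using that assms r[of x y] by (auto simp: sym_def irrefl_def)
  then have "orients A (A \<inter> r)"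
    unfolding orients_def by (intro conjI equalityI subrelI) blast+
  then show ?thesis by blast
qed

text \<open>Every arc that leaves a vertex of \<open>W\<close> also enters a vertex of
  \<open>W\<close>, so the outdegrees sum to at most the sum of the indegrees.\<close>

lemma sum_excess_closed_le_0:
  assumes D: "finite D" and W: "finite W" "D `` W \<subseteq> W"
  shows "(\<Sum>x\<in>W. excess D x) \<le> 0"
proof -
  have fin: "finite (D `` {y})" "finite (D\<inverse> `` {y})" for y
    using D by (auto intro: finite_Image)
  have "(\<Sum>x\<in>W. card (D `` {x})) = card (SIGMA x:W. D `` {x})"
    using W fin by (simp add: card_SigmaI)
  also have "\<dots> \<le> card (SIGMA x:W. D\<inverse> `` {x})"
    by (rule card_inj_on_le[of "\<lambda>(x, y). (y, x)"]) (use W fin in \<open>auto simp: inj_on_def\<close>)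
  also have "\<dots> = (\<Sum>x\<in>W. card (D\<inverse> `` {x}))"
    using W fin by (simp add: card_SigmaI)
  finally show ?thesis
    by (simp add: excess_def sum_subtractf flip: of_nat_sum)
qed

lemma balanced_orientation:
  assumes A: "finite A" "sym A" "irrefl A"
  shows "\<exists>D. orients A D \<and> (\<forall>v. \<bar>excess D v\<bar> \<le> 1)"
proof -
  define V where "V = Field A"
  have V: "finite V" using A by (simp add: V_def finite_Field)
  \<comment> \<open>A vertex with excess at least 2 reaches one with negative excess; reversing a path between them decreases \<open>\<Phi>\<close>.\<close>
  define \<Phi> where "\<Phi> D = (\<Sum>v\<in>V. nat ((excess D v)\<^sup>2))" for D
  obtain D where D: "orients A D" and min: "\<And>D'. orients A D' \<Longrightarrow> \<Phi> D \<le> \<Phi> D'"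
    using exists_orientation[OF A(2,3)] ex_has_least_nat[of "orients A" _ \<Phi>] by blast
  have no_large: "excess D v \<le> 1" if D: "orients A D" and min: "\<And>D'. orients A D' \<Longrightarrow> \<Phi> D \<le> \<Phi> D'" for D v
  proof (rule ccontr)
    assume v: "\<not> excess D v \<le> 1"
    have finD: "finite D" and DV: "D \<subseteq> V \<times> V"
      using D A(1) finite_subset by (auto simp: orients_def V_def Field_def)
    have "D `` {v} \<noteq> {}" using v by (auto simp: excess_def)
    then have vV: "v \<in> V" using DV by auto
    define W where "W = D\<^sup>* `` {v}"
    have WV: "W \<subseteq> V"
    proof
      fix w assume "w \<in> W"
      then have "(v, w) \<in> D\<^sup>*" by (simp add: W_def)
      then show "w \<in> V" using vV DV by (induction) auto
    qed
    have vW: "v \<in> W" by (simp add: W_def)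
    \<comment> \<open>The reachable set \<open>W\<close> is closed under arcs, so its total excess
      is at most 0; the positive excess of \<open>v\<close> has to be compensated inside
      \<open>W\<close>.\<close>
    have "\<exists>w\<in>W. excess D w < 0"
    proof (rule ccontr)
      assume "\<not> (\<exists>w\<in>W. excess D w < 0)"
      then have "excess D v \<le> (\<Sum>x\<in>W. excess D x)"
        using WV V vW finite_subset by (intro member_le_sum) (auto simp: not_less)
      also have "\<dots> \<le> 0"
        using finD finite_subset[OF WV V]
        by (intro sum_excess_closed_le_0) (auto simp: W_def intro: rtrancl_into_rtrancl)
      finally show False using v by simp
    qed
    then obtain w where w: "w \<in> W" "excess D w < 0" by blast
    then obtain p where p: "hd (p @ [w]) = v" "distinct (p @ [w])"
      "successively (\<lambda>x y. (x, y) \<in> D) (p @ [w])"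
      using rtrancl_imp_distinct_path[of v w D] by (auto simp: W_def)
    have "p \<noteq> []" using p(1) w(2) v by auto
    then obtain q where q: "p = v # q" using p(1) by (cases p) auto
    have vw: "v \<noteq> w" using w v by auto
    obtain D' where D': "orients A D'"
      and e: "\<And>x. excess D' x = excess D x - (if x = v then 2 else 0) + (if x = w then 2 else 0)"
      using orients_reverse_path[OF A(1) D, of v "q @ [w]"] p by (auto simp: q)
    have "\<Phi> D' < \<Phi> D"
    proof -
      have split: "\<Phi> D'' = nat ((excess D'' v)\<^sup>2) + nat ((excess D'' w)\<^sup>2)
          + (\<Sum>x\<in>V - {v, w}. nat ((excess D'' x)\<^sup>2))" for D''
      proof -
        have "V = insert v (insert w (V - {v, w}))" using vV w WV by auto
        then have "\<Phi> D'' = (\<Sum>x\<in>insert v (insert w (V - {v, w})). nat ((excess D'' x)\<^sup>2))"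
          unfolding \<Phi>_def by simp
        then show ?thesis using V vw by simp
      qed
      have same: "(\<Sum>x\<in>V - {v, w}. nat ((excess D' x)\<^sup>2)) = (\<Sum>x\<in>V - {v, w}. nat ((excess D x)\<^sup>2))"
        by (intro sum.cong) (auto simp: e)
      \<comment> \<open>The sum of squares changes by
        \<open>4 * (excess D w - excess D v + 2)\<close>, which is negative because the two values
        differ by at least 3.\<close>
      have "(excess D v - 2)\<^sup>2 + (excess D w + 2)\<^sup>2 < (excess D v)\<^sup>2 + (excess D w)\<^sup>2"
        using v w(2) by (simp add: power2_eq_square algebra_simps)
      then have "int (nat ((excess D v - 2)\<^sup>2) + nat ((excess D w + 2)\<^sup>2))
          < int (nat ((excess D v)\<^sup>2) + nat ((excess D w)\<^sup>2))"
        by simp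
      then have "nat ((excess D v - 2)\<^sup>2) + nat ((excess D w + 2)\<^sup>2)
          < nat ((excess D v)\<^sup>2) + nat ((excess D w)\<^sup>2)"
        by (simp only: of_nat_less_iff)
      then show ?thesis unfolding split same using vw by (simp add: e)
    qed
    then show False using min[OF D'] by simp
  qed
  \<comment> \<open>The squares in \<open>\<Phi>\<close> ignore signs, so the converse is a
    minimiser too, and its upper bound is the lower bound for \<open>D\<close>.\<close>
  have "excess (D\<inverse>) v \<le> 1" for v
  proof (rule no_large)
    show "orients A (D\<inverse>)" using D by (auto simp: orients_def)
    show "\<Phi> (D\<inverse>) \<le> \<Phi> D'" if "orients A D'" for D'
      using min[OF that] by (simp add: \<Phi>_def excess_converse)
  qed
  then have "\<bar>excess D v\<bar> \<le> 1" for v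
    using no_large[OF D min, of v] by (simp add: excess_converse abs_le_iff)
  then show ?thesis using D by blast
qed

section \<open>Kalkowski's total weighting\<close>

text \<open>
  Adding a vertex \<open>v\<close> with \<open>k\<close> earlier neighbours: an edge from \<open>v\<close> to such a neighbour \<open>u\<close> starts with
  weight 2 and may be changed by one if \<open>x u\<close> absorbs the change, so that \<open>t u\<close> is kept. Together with
  \<open>x v\<close> this leaves \<open>k + 2\<close> consecutive values for \<open>t v\<close>, of which the smallest is discarded
  to obtain the lower bound.
\<close>

lemma kalkowski_total_weighting:
  fixes adj :: "'a \<Rightarrow> 'a \<Rightarrow> bool" and z :: "'a \<Rightarrow> nat"
  assumes "finite U" and sym: "\<And>u v. adj u v \<Longrightarrow> adj v u" and irr: "\<And>v. \<not> adj v v"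
  shows "\<exists>\<omega> :: 'a set \<Rightarrow> nat. \<exists>x :: 'a \<Rightarrow> nat. \<exists>t.
    (\<forall>e. \<omega> e \<in> {1, 2, 3}) \<and> (\<forall>u. x u \<le> 1) \<and>
    (\<forall>u\<in>U. t u = z u + x u + (\<Sum>v | v \<in> U \<and> adj u v. \<omega> {u, v})) \<and>
    (\<forall>u\<in>U. \<forall>v\<in>U. adj u v \<longrightarrow> t u \<noteq> t v) \<and>
    (\<forall>u\<in>U. z u + card {v \<in> U. adj u v} < t u)"
  using assms(1)
proof (induction U arbitrary: z rule: finite_induct)
  case empty
  show ?case by (intro exI[of _ "\<lambda>_. 1"] exI[of _ "\<lambda>_. 0"]) auto
next
  case (insert v U)
  define K where "K = {u \<in> U. adj v u}"
  have K: "finite K" "v \<notin> K" using insert.hyps by (auto simp: K_def)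
  \<comment> \<open>Raising \<open>z\<close> by 2 on \<open>K\<close> anticipates the default weight
    2 of the edges to \<open>v\<close>, so the values \<open>t u\<close> of old vertices can stay
    fixed.\<close>
  obtain \<omega> x t where IH: "\<And>e. \<omega> e \<in> {1, 2, 3}" "\<And>u. x u \<le> 1"
    "\<And>u. u \<in> U \<Longrightarrow> t u = z u + (if u \<in> K then 2 else 0) + x u + (\<Sum>v | v \<in> U \<and> adj u v. \<omega> {u, v})"
    "\<And>u w. u \<in> U \<Longrightarrow> w \<in> U \<Longrightarrow> adj u w \<Longrightarrow> t u \<noteq> t w"
    "\<And>u. u \<in> U \<Longrightarrow> z u + (if u \<in> K then 2 else 0) + card {v \<in> U. adj u v} < t u"
    using insert.IH[of "\<lambda>u. z u + (if u \<in> K then 2 else 0)"] by blast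
  define K0 where "K0 = {u \<in> K. x u = 0}"
  define K1 where "K1 = {u \<in> K. x u = 1}"
  have K01: "K = K0 \<union> K1" "K0 \<inter> K1 = {}" "finite K0" "finite K1"
    using IH(2) K by (auto simp: K0_def K1_def le_Suc_eq)
  then have cK: "card K = card K0 + card K1" by (simp add: card_Un_disjoint)
  \<comment> \<open>Pigeonhole: \<open>card K + 1\<close> candidates face at most
    \<open>card K\<close> forbidden values. The attainable value
    \<open>z v + card K + card K1\<close> is omitted because the final bound is strict.\<close>
  have "\<not> {z v + card K + card K1 + 1..z v + card K + card K1 + card K + 1} \<subseteq> t ` K"
  proof
    assume "{z v + card K + card K1 + 1..z v + card K + card K1 + card K + 1} \<subseteq> t ` K"
    then have "card {z v + card K + card K1 + 1..z v + card K + card K1 + card K + 1} \<le> card K"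
      using surj_card_le[OF K(1)] by blast
    then show False by simp
  qed
  then obtain s where "s \<in> {z v + card K + card K1 + 1..z v + card K + card K1 + card K + 1}"
    and s3: "s \<notin> t ` K" by blast
  then have s: "z v + card K + card K1 < s" "s \<le> z v + card K + card K1 + card K + 1" "s \<notin> t ` K"
    by auto
  \<comment> \<open>Edges to \<open>M0\<close> are lowered to 1 and edges to \<open>M1\<close>
    raised to 3. Values up to \<open>z v + 2 * card K\<close> need only lowering, the next
    \<open>card K1\<close> only raising, and the largest one uses \<open>b = 1\<close> as
    well.\<close>
  obtain M0 M1 b where M: "M0 \<subseteq> K0" "M1 \<subseteq> K1" "b \<le> 1"
    and sM: "s + card M0 = z v + b + 2 * card K + card M1"
  proof (cases "s \<le> z v + 2 * card K")
    case True
    have "z v + 2 * card K - s \<le> card K0" using s cK by linarith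
    then obtain M0 where "M0 \<subseteq> K0" "card M0 = z v + 2 * card K - s"
      using obtain_subset_with_card_n by blast
    then show ?thesis using that[of M0 "{}" 0] True by auto
  next
    case False
    show ?thesis
    proof (cases "s \<le> z v + 2 * card K + card K1")
      case True
      then have "s - (z v + 2 * card K) \<le> card K1" by linarith
      then obtain M1 where "M1 \<subseteq> K1" "card M1 = s - (z v + 2 * card K)"
        using obtain_subset_with_card_n by blast
      then show ?thesis using that[of "{}" M1 0] False by auto
    next
      case False
      then show ?thesis using that[of "{}" K1 1] s by auto
    qed
  qed
  have fM: "finite M0" "finite M1" using M K01 finite_subset by blast+
  have disj: "M0 \<inter> M1 = {}" "M0 \<subseteq> K" "M1 \<subseteq> K" using M K01 by auto
  define \<delta> :: "'a \<Rightarrow> nat" where "\<delta> u = (if u \<in> M0 then 1 else if u \<in> M1 then 3 else 2)" for u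
  \<comment> \<open>\<open>the_elem\<close> picks the other endpoint of an edge at \<open>v\<close>.
    On any other set containing \<open>v\<close> its value is irrelevant, as \<open>\<delta>\<close>
    always lies between 1 and 3.\<close>
  define \<omega>' where "\<omega>' e = (if v \<in> e then \<delta> (the_elem (e - {v})) else \<omega> e)" for e
  define x' where "x' u = (if u = v then b else if u \<in> M0 then 1 else if u \<in> M1 then 0 else x u)" for u
  define t' where "t' = t(v := s)"
  have \<omega>'v: "\<omega>' {v, u} = \<delta> u" "\<omega>' {u, v} = \<delta> u" if "u \<noteq> v" for u
  proof -
    have "{v, u} - {v} = {u}" "{u, v} - {v} = {u}" using that by auto
    then show "\<omega>' {v, u} = \<delta> u" "\<omega>' {u, v} = \<delta> u" by (auto simp: \<omega>'_def)
  qed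
  have sum_old: "(\<Sum>w | w \<in> U \<and> adj u w. \<omega>' {u, w}) = (\<Sum>w | w \<in> U \<and> adj u w. \<omega> {u, w})" if "u \<in> U" for u
    using that insert.hyps by (intro sum.cong) (auto simp: \<omega>'_def)
  have nb_in: "{w. w \<in> insert v U \<and> adj u w} = insert v {w. w \<in> U \<and> adj u w}" if "u \<in> K" for u
    using that sym by (auto simp: K_def)
  have nb_out: "{w. w \<in> insert v U \<and> adj u w} = {w. w \<in> U \<and> adj u w}" if "u \<in> U" "u \<notin> K" for u
    using that sym by (auto simp: K_def)
  have nb_v: "{w. w \<in> insert v U \<and> adj v w} = K"
    using irr by (auto simp: K_def)
  have "t' u = z u + x' u + (\<Sum>w | w \<in> insert v U \<and> adj u w. \<omega>' {u, w})" if "u \<in> insert v U" for u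
  proof (cases "u = v")
    case True
    have "(\<Sum>w\<in>K. \<omega>' {v, w}) = (\<Sum>w\<in>K. \<delta> w)"
      using K by (intro sum.cong) (auto intro: \<omega>'v)
    moreover have "(\<Sum>w\<in>K. \<delta> w) + card M0 = 2 * card K + card M1"
    proof -
      have "(\<Sum>w\<in>K. \<delta> w) + (\<Sum>w\<in>K. if w \<in> M0 then 1 else 0) = (\<Sum>w\<in>K. 2) + (\<Sum>w\<in>K. if w \<in> M1 then 1 else 0)"
        unfolding sum.distrib[symmetric] using disj by (intro sum.cong) (auto simp: \<delta>_def)
      moreover have "K \<inter> M0 = M0" "K \<inter> M1 = M1" using disj by auto
      ultimately show ?thesis using K by (simp flip: sum.inter_restrict)
    qed
    ultimately show ?thesis using sM nb_v True by (simp add: t'_def x'_def)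
  next
    case False
    then have u: "u \<in> U" using that by auto
    show ?thesis
    proof (cases "u \<in> K")
      case True
      \<comment> \<open>The vertex weight absorbs the change of the edge weight: 0 becomes 1 on
        \<open>M0\<close>, and 1 becomes 0 on \<open>M1\<close>.\<close>
      have "x' u + \<delta> u = x u + 2"
        using M disj False by (auto simp: x'_def \<delta>_def K0_def K1_def)
      then show ?thesis
        using IH(3)[OF u] False True sum_old[OF u] insert.hyps \<omega>'v[OF False]
          nb_in[OF True] by (simp add: t'_def)
    next
      case nK: False
      then have "x' u = x u" using disj False by (auto simp: x'_def)
      then show ?thesis
        using IH(3)[OF u] False nK sum_old[OF u] nb_out[OF u nK] by (simp add: t'_def)
    qed
  qed
  moreover have "t' u \<noteq> t' w" if "u \<in> insert v U" "w \<in> insert v U" "adj u w" for u w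
    using that IH(4) s(3) irr sym by (auto simp: t'_def K_def)
  moreover have "z u + card {w \<in> insert v U. adj u w} < t' u" if "u \<in> insert v U" for u
  proof (cases "u = v")
    case True
    then show ?thesis using s nb_v by (simp add: t'_def)
  next
    case False
    then have u: "u \<in> U" using that by auto
    then show ?thesis
      using IH(5)[OF u] False insert.hyps nb_in[of u] nb_out[OF u] by (cases "u \<in> K") (auto simp: t'_def)
  qed
  moreover have "\<omega>' e \<in> {1, 2, 3}" for e using IH(1) by (auto simp: \<omega>'_def \<delta>_def)
  moreover have "x' u \<le> 1" for u using IH(2) M(3) by (auto simp: x'_def)
  ultimately show ?case
    by (intro exI[of _ \<omega>'] exI[of _ x'] exI[of _ t'] conjI allI ballI impI)
qed

section \<open>Weighting one half\<close>

definition nbh :: "'a set set \<Rightarrow> 'a \<Rightarrow> 'a set" where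
  "nbh E v = {u. {v, u} \<in> E}"

lemma bij_betw_nbh:
  assumes "\<And>e. e \<in> E \<Longrightarrow> card e = 2"
  shows "bij_betw (\<lambda>u. {v, u}) (nbh E v) (incident_edges E v)"
  unfolding bij_betw_def
proof
  show "inj_on (\<lambda>u. {v, u}) (nbh E v)" by (auto simp: inj_on_def doubleton_eq_iff)
  show "(\<lambda>u. {v, u}) ` nbh E v = incident_edges E v"
  proof
    show "incident_edges E v \<subseteq> (\<lambda>u. {v, u}) ` nbh E v"
    proof
      fix e assume e: "e \<in> incident_edges E v"
      then obtain a b where "e = {a, b}" "a \<noteq> b"
        using assms[of e] by (auto simp: incident_edges_def card_2_iff)
      then have "e = {v, a} \<or> e = {v, b}" using e by (auto simp: incident_edges_def)
      then show "e \<in> (\<lambda>u. {v, u}) ` nbh E v"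
        using e by (auto simp: nbh_def incident_edges_def)
    qed
  qed (auto simp: nbh_def incident_edges_def)
qed

lemma weighted_sum_nbh:
  assumes "\<And>e. e \<in> E \<Longrightarrow> card e = 2"
  shows "weighted_sum E w v = (\<Sum>u\<in>nbh E v. w {v, u})"
  unfolding weighted_sum_def using sum.reindex_bij_betw[OF bij_betw_nbh[OF assms], of E w v] by simp

context simple_graph
begin

lemma nbh_subset: "nbh E v \<subseteq> V"
  using edge_subset by (auto simp: nbh_def)

lemma finite_nbh: "finite (nbh E v)"
  using nbh_subset finite_verts finite_subset by blast

lemma nbh_sym: "u \<in> nbh E v \<longleftrightarrow> v \<in> nbh E u"
  by (simp add: nbh_def insert_commute)

lemma nbh_irrefl: "v \<notin> nbh E v"
  using edge_card[of "{v}"] by (auto simp: nbh_def)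

text \<open>The threshold \<open>m\<close> separates the sums: those in \<open>U\<close> exceed it,
  those outside do not. No edge of this graph lies outside \<open>U\<close>, so Kalkowski's
  weighting is needed only for edges inside \<open>U\<close>.\<close>

lemma fulfills_123_half:
  assumes U: "U \<subseteq> V" and D: "D \<subseteq> U \<times> (V - U)" "\<And>u h. (u, h) \<in> D \<Longrightarrow> {u, h} \<in> E"
    and out: "\<And>u. u \<in> U \<Longrightarrow> D `` {u} \<noteq> {}"
    and large: "\<And>u. u \<in> U \<Longrightarrow> m < 2 * card (D `` {u}) + card (nbh E u \<inter> U)"
    and small: "\<And>h. h \<in> V - U \<Longrightarrow> 2 * card (D\<inverse> `` {h}) \<le> m"
  shows "fulfills_123 V ({e \<in> E. e \<subseteq> U} \<union> (\<lambda>(u, h). {u, h}) ` D)"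
proof -
  define F where "F = {e \<in> E. e \<subseteq> U} \<union> (\<lambda>(u, h). {u, h}) ` D"
  have finU: "finite U" using U finite_verts finite_subset by blast
  have finD: "finite D" using D(1) finU finite_verts by (meson finite_Diff finite_SigmaI finite_subset)
  then have fin: "finite (D `` {y})" "finite (D\<inverse> `` {y})" for y
    by (auto intro: finite_Image)
  have F2: "card e = 2" if "e \<in> F" for e using that D(2) edge_card by (auto simp: F_def)
  define a where "a u = nbh E u \<inter> U" for u
  have nbU: "nbh F u = a u \<union> D `` {u}" "a u \<inter> D `` {u} = {}" "finite (a u)" if "u \<in> U" for u
    using that D finU by (auto simp: nbh_def F_def a_def doubleton_eq_iff)
  have nbH: "nbh F h = D\<inverse> `` {h}" if "h \<in> V - U" for h
    using that D by (auto simp: nbh_def F_def doubleton_eq_iff)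
  have E_sym: "{v, u} \<in> E" if "{u, v} \<in> E" for u v using that by (simp add: insert_commute)
  have E_irrefl: "{v, v} \<notin> E" for v using nbh_irrefl[of v] by (simp add: nbh_def)
  \<comment> \<open>The arcs leaving \<open>u\<close> will contribute 2 each, except for a private
    one contributing \<open>1 + x u\<close>; hence the offset \<open>2 * card - 1\<close>.\<close>
  obtain \<omega> x t where w: "\<And>e. \<omega> e \<in> {1, 2, 3 :: nat}" "\<And>u. x u \<le> (1 :: nat)"
    "\<And>u. u \<in> U \<Longrightarrow> t u = 2 * card (D `` {u}) - 1 + x u + (\<Sum>v | v \<in> U \<and> {u, v} \<in> E. \<omega> {u, v})"
    "\<And>u v. u \<in> U \<Longrightarrow> v \<in> U \<Longrightarrow> {u, v} \<in> E \<Longrightarrow> t u \<noteq> t v"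
    "\<And>u. u \<in> U \<Longrightarrow> 2 * card (D `` {u}) - 1 + card {v \<in> U. {u, v} \<in> E} < t u"
    using kalkowski_total_weighting[where adj = "\<lambda>u v. {u, v} \<in> E"
        and z = "\<lambda>u. 2 * card (D `` {u}) - 1", OF finU E_sym E_irrefl] by blast
  have a_eq: "{v \<in> U. {u, v} \<in> E} = a u" for u by (auto simp: a_def nbh_def)
  define pr where "pr u = (SOME h. (u, h) \<in> D)" for u
  have pr: "(u, pr u) \<in> D" if "u \<in> U" for u
    using out[OF that] unfolding pr_def by (auto intro: someI)
  define W where "W e = (if e \<subseteq> U then \<omega> e else if \<exists>u\<in>U. e = {u, pr u} \<and> x u = 0 then 1 else 2)" for e
  have W_D: "W {u, h} = (if h = pr u \<and> x u = 0 then 1 else 2)" if "(u, h) \<in> D" for u h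
  proof -
    have inside: "({u, h} \<subseteq> U) = False" using that D by auto
    \<comment> \<open>An arc of \<open>D\<close> has only its tail in \<open>U\<close>, so its edge
      can be private to no other vertex.\<close>
    have priv: "(\<exists>u'\<in>U. {u, h} = {u', pr u'} \<and> x u' = 0) \<longleftrightarrow> h = pr u \<and> x u = 0"
      using that D(1) pr by (fastforce simp: doubleton_eq_iff)
    show ?thesis unfolding W_def inside priv by simp
  qed
  have sumU: "weighted_sum F W u = t u" if u: "u \<in> U" for u
  proof -
    have "(\<Sum>h\<in>D `` {u}. W {u, h}) = (\<Sum>h\<in>D `` {u}. if h = pr u then 1 + x u else 2)"
      using W_D w(2)[of u] by (intro sum.cong) (auto simp: le_Suc_eq)
    also have "\<dots> = (1 + x u) + (\<Sum>h\<in>D `` {u} - {pr u}. if h = pr u then 1 + x u else 2)"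
      using pr[OF u] fin by (subst sum.remove[of _ "pr u"]) auto
    also have "(\<Sum>h\<in>D `` {u} - {pr u}. if h = pr u then 1 + x u else 2) = (\<Sum>h\<in>D `` {u} - {pr u}. 2)"
      by (intro sum.cong) auto
    also have "1 + x u + \<dots> = 2 * card (D `` {u}) - 1 + x u"
    proof -
      have "card (D `` {u}) > 0" using pr[OF u] fin by (auto simp: card_gt_0_iff)
      then show ?thesis using pr[OF u] fin by (simp add: card_Diff_singleton)
    qed
    finally have *: "(\<Sum>h\<in>D `` {u}. W {u, h}) = 2 * card (D `` {u}) - 1 + x u" .
    have "(\<Sum>v\<in>a u. W {u, v}) = (\<Sum>v\<in>a u. \<omega> {u, v})"
      using u by (intro sum.cong) (auto simp: W_def a_def)
    then show ?thesis
      using weighted_sum_nbh[OF F2, of F W u] nbU[OF u] w(3)[OF u] * fin a_eq[of u]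
      by (simp add: sum.union_disjoint)
  qed
  have sumH: "weighted_sum F W h \<le> m" if h: "h \<in> V - U" for h
  proof -
    have "weighted_sum F W h = (\<Sum>u\<in>D\<inverse> `` {h}. W {h, u})"
      using weighted_sum_nbh[OF F2, of F W h] nbH[OF h] by simp
    also have "\<dots> \<le> (\<Sum>u\<in>D\<inverse> `` {h}. 2)"
      using W_D by (intro sum_mono) (auto simp: insert_commute)
    also have "\<dots> \<le> m" using small[OF h] by simp
    finally show ?thesis .
  qed
  \<comment> \<open>The strict lower bound in Kalkowski's weighting makes up for the 1 subtracted in
    the offset.\<close>
  have large': "m < t u" if "u \<in> U" for u
  proof -
    have "card (D `` {u}) > 0" using pr[OF that] fin by (auto simp: card_gt_0_iff)
    then show ?thesis using large[OF that] w(5)[OF that] a_eq[of u] by (simp add: a_def)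
  qed
  have "weighted_sum F W u \<noteq> weighted_sum F W v" if "{u, v} \<in> F" for u v
  proof -
    consider "{u, v} \<in> E" "u \<in> U" "v \<in> U" | "u \<in> U" "v \<in> V - U" | "v \<in> U" "u \<in> V - U"
      using \<open>{u, v} \<in> F\<close> by (auto simp: F_def doubleton_eq_iff dest!: subsetD[OF D(1)])
    then show ?thesis
    proof cases
      case 1
      then show ?thesis using w(4) sumU by simp
    next
      case 2
      then show ?thesis using sumU[of u] sumH[of v] large'[of u] by simp
    next
      case 3
      then show ?thesis using sumU[of v] sumH[of u] large'[of v] by simp
    qed
  qed
  moreover have "W e \<in> {1, 2, 3}" for e using w(1) by (auto simp: W_def)
  ultimately show ?thesis unfolding fulfills_123_def F_def[symmetric] by blast
qed

end

text \<open>The threshold is \<open>d - 2\<close>. Inside \<open>U\<close>, indegree, outdegree and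
  inner degree add up to \<open>d\<close>, and balance makes twice the outdegree plus the inner
  degree at least \<open>d - 1\<close>. Outside \<open>U\<close>, more than \<open>c\<close>
  neighbours avoid \<open>U\<close>, which keeps the indegree small.\<close>

lemma (in simple_graph) fulfills_123_half_of_orientation:
  assumes U: "U \<subseteq> V" and reg: "\<And>v. v \<in> V \<Longrightarrow> card (nbh E v) = d"
    and balanced: "\<And>v. v \<in> V \<Longrightarrow> c < card (nbh E v \<inter> U) \<and> card (nbh E v \<inter> U) + c < d"
    and c: "even d \<and> c = 1 \<or> c = 2"
    and D: "orients {(u, v). {u, v} \<in> E \<and> (u \<in> U \<longleftrightarrow> v \<notin> U)} D" "\<And>v. \<bar>excess D v\<bar> \<le> 1"
  shows "fulfills_123 V ({e \<in> E. e \<subseteq> U} \<union> (\<lambda>(u, h). {u, h}) ` (D \<inter> U \<times> (V - U)))"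
proof -
  define D' where "D' = D \<inter> U \<times> (V - U)"
  define A where "A = {(u, v). {u, v} \<in> E \<and> (u \<in> U \<longleftrightarrow> v \<notin> U)}"
  have DA: "D \<inter> D\<inverse> = {}" "D \<union> D\<inverse> = A" using D(1) by (auto simp: orients_def A_def)
  have AV: "(u, v) \<in> A \<Longrightarrow> u \<in> V \<and> v \<in> V" for u v using edge_subset by (auto simp: A_def)
  have D_iff: "(u, v) \<in> D \<Longrightarrow> (u, v) \<in> A" for u v using DA by blast
  have finA: "finite A" by (rule finite_subset[of A "V \<times> V"]) (use AV finite_verts in auto)
  then have fin: "finite (D `` {v})" "finite (D\<inverse> `` {v})" for v
    using DA finite_subset[of D A] by (auto intro!: finite_Image)
  have cut: "card (D `` {v}) + card (D\<inverse> `` {v}) = card (A `` {v})" for v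
  proof -
    have "A `` {v} = D `` {v} \<union> D\<inverse> `` {v}" "D `` {v} \<inter> D\<inverse> `` {v} = {}" using DA by auto
    then show ?thesis using fin by (simp add: card_Un_disjoint)
  qed
  have A_in: "A `` {u} = nbh E u - U" if "u \<in> U" for u using that by (auto simp: A_def nbh_def)
  have A_out: "A `` {h} = nbh E h \<inter> U" if "h \<notin> U" for h using that by (auto simp: A_def nbh_def)
  have nb: "card (nbh E u - U) + card (nbh E u \<inter> U) = d" if "u \<in> V" for u
    using card_Diff_subset_Int[of "nbh E u" U] reg[OF that] finite_nbh[of u]
      card_mono[OF finite_nbh[of u], of "nbh E u \<inter> U"] by simp
  have D'_out: "D' `` {u} = D `` {u}" if "u \<in> U" for u
    using that D_iff AV by (fastforce simp: D'_def A_def)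
  have D'_in: "D'\<inverse> `` {h} = D\<inverse> `` {h}" if "h \<in> V - U" for h
    using that D_iff by (fastforce simp: D'_def A_def)
  have diff: "card (D `` {v}) \<le> card (D\<inverse> `` {v}) + 1" "card (D\<inverse> `` {v}) \<le> card (D `` {v}) + 1" for v
    using D(2)[of v] by (auto simp: excess_def)
  have out: "d - 2 < 2 * card (D' `` {u}) + card (nbh E u \<inter> U)" "D' `` {u} \<noteq> {}" if u: "u \<in> U" for u
  proof -
    have uV: "u \<in> V" using u U by blast
    have b: "card (D `` {u}) + card (D\<inverse> `` {u}) + card (nbh E u \<inter> U) = d"
      using cut[of u] nb[OF uV] A_in[OF u] by simp
    then show "d - 2 < 2 * card (D' `` {u}) + card (nbh E u \<inter> U)"
      using diff(2)[of u] conjunct1[OF balanced[OF uV]] conjunct2[OF balanced[OF uV]]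
      unfolding D'_out[OF u] by linarith
    \<comment> \<open>At least \<open>c + 1 \<ge> 2\<close> cut edges meet \<open>u\<close>, so a
      balanced orientation lets one of them leave \<open>u\<close>.\<close>
    have "card (D `` {u}) > 0" using b balanced[OF uV] c diff[of u] by auto
    then show "D' `` {u} \<noteq> {}" using D'_out[OF u] by auto
  qed
  have inn: "2 * card (D'\<inverse> `` {h}) \<le> d - 2" if h: "h \<in> V - U" for h
  proof -
    have "card (D `` {h}) + card (D\<inverse> `` {h}) + c < d"
      using cut[of h] A_out[of h] balanced[of h] h by simp
    then have "2 * card (D\<inverse> `` {h}) + c \<le> d" using diff[of h] by linarith
    \<comment> \<open>For \<open>c = 1\<close> the bound is only \<open>d - 1\<close>, but this is
      odd when \<open>d\<close> is even, so the even left side loses one more.\<close>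
    then have "2 * card (D\<inverse> `` {h}) \<le> d - 2" using c
    proof (elim disjE conjE)
      assume "2 * card (D\<inverse> `` {h}) + c \<le> d" "even d" "c = 1"
      then show ?thesis by presburger
    qed simp
    then show ?thesis using D'_in[OF h] by simp
  qed
  have "{u, h} \<in> E" if "(u, h) \<in> D'" for u h
    using that D_iff by (auto simp: D'_def A_def)
  then show ?thesis
    using fulfills_123_half[OF U, of D' "d - 2"] out inn by (auto simp: D'_def)
qed

section \<open>Balanced bipartitions of regular graphs\<close>

lemma card_Pow_card_le:
  assumes "finite N"
  shows "card {X \<in> Pow N. card X \<le> c} = (\<Sum>i\<le>c. card N choose i)"
proof -
  have "{X \<in> Pow N. card X \<le> c} = (\<Union>i\<le>c. {X. X \<subseteq> N \<and> card X = i})" by auto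
  then have "card {X \<in> Pow N. card X \<le> c} = (\<Sum>i\<le>c. card {X. X \<subseteq> N \<and> card X = i})"
    using assms by (simp, subst card_UN_disjoint) auto
  then show ?thesis using assms by (simp add: n_subsets)
qed

lemma card_Pow_card_ge:
  assumes "finite N"
  shows "card {X \<in> Pow N. card N \<le> card X + c} = (\<Sum>i\<le>c. card N choose i)"
proof -
  have compl: "card (N - X) = card N - card X" "card X \<le> card N" if "X \<subseteq> N" for X
    using that assms finite_subset by (auto intro: card_Diff_subset card_mono)
  have "bij_betw (\<lambda>X. N - X) {X \<in> Pow N. card N \<le> card X + c} {X \<in> Pow N. card X \<le> c}"
    by (rule bij_betw_byWitness[where f' = "\<lambda>X. N - X"]) (use compl in auto)
  from bij_betw_same_card[OF this] show ?thesis using card_Pow_card_le[OF assms] by simp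
qed

text \<open>With \<open>x = 1 / (D + 1)\<close> this turns the local lemma condition into the
  symmetric form \<open>exp 1 * p * (D + 1) \<le> 1\<close>. It is the reciprocal of
  \<open>(1 + 1 / D) ^ D \<le> exp 1\<close>.\<close>

lemma exp_one_power_bound: "exp (- 1) \<le> (1 - 1 / (real D + 1)) ^ D"
proof (cases "D = 0")
  case False
  then have "(1 + 1 / real D) ^ D \<le> exp (1 / real D) ^ D"
    by (intro power_mono exp_ge_add_one_self) auto
  also have "\<dots> = exp 1" using False by (simp flip: exp_of_nat_mult)
  finally have "inverse (exp 1) \<le> inverse ((1 + 1 / real D) ^ D)"
    by (intro le_imp_inverse_le) (auto intro!: zero_less_power add_pos_nonneg)
  also have "inverse ((1 + 1 / real D) ^ D) = (1 - 1 / (real D + 1)) ^ D"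
    using False by (simp add: field_simps flip: power_inverse)
  finally show ?thesis by (simp add: exp_minus)
qed simp

text \<open>For a random \<open>R\<close>, the bad event at \<open>v\<close> is that at most
  \<open>c\<close> neighbours lie in \<open>R\<close> or at most \<open>c\<close> lie outside. The
  two tails have equal size, which gives the factor 2 in \<open>bound\<close>.\<close>

lemma (in simple_graph) exists_balanced_bipartition:
  assumes reg: "\<And>v. v \<in> V \<Longrightarrow> card (nbh E v) = d" and d: "2 \<le> d"
    and bound: "2 * real (\<Sum>i\<le>c. d choose i) * (real (d * (d - 1)) + 1) * exp 1 \<le> 2 ^ d"
  shows "\<exists>R\<subseteq>V. \<forall>v\<in>V. c < card (nbh E v \<inter> R) \<and> card (nbh E v \<inter> R) + c < d"
proof -
  define bad where "bad v R \<longleftrightarrow> card (R \<inter> nbh E v) \<le> c \<or> d \<le> card (R \<inter> nbh E v) + c" for v R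
  define D where "D = d * (d - 1)"
  define Q where "Q = (\<Sum>i\<le>c. d choose i)"
  have "\<exists>R\<subseteq>V. \<forall>v\<in>V. \<not> bad v R"
  proof (rule lovasz_local_lemma[where N = "nbh E" and D = D and p = "2 * real Q / 2 ^ d"
        and x = "1 / (real D + 1)"])
    show "card {j \<in> V. j \<noteq> i \<and> nbh E j \<inter> nbh E i \<noteq> {}} \<le> D" if i: "i \<in> V" for i
    proof -
      \<comment> \<open>A vertex sharing a neighbour with \<open>i\<close> is one of the
        \<open>d - 1\<close> further neighbours of one of the \<open>d\<close> neighbours of
        \<open>i\<close>.\<close>
      have "card {j \<in> V. j \<noteq> i \<and> nbh E j \<inter> nbh E i \<noteq> {}} \<le> card (\<Union>u\<in>nbh E i. nbh E u - {i})"
        using finite_nbh nbh_sym by (intro card_mono) auto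
      also have "\<dots> \<le> (\<Sum>u\<in>nbh E i. card (nbh E u - {i}))"
        by (rule card_UN_le[OF finite_nbh])
      also have "\<dots> = (\<Sum>u\<in>nbh E i. d - 1)"
      proof (rule sum.cong)
        fix u assume "u \<in> nbh E i"
        then show "card (nbh E u - {i}) = d - 1"
          using reg[of u] nbh_subset nbh_sym[of u i] by (auto simp: card_Diff_singleton)
      qed simp
      finally show ?thesis using reg[OF i] by (simp add: D_def)
    qed
    show "real (card {R \<in> Pow V. bad i R}) \<le> 2 * real Q / 2 ^ d * 2 ^ card V" if i: "i \<in> V" for i
    proof -
      let ?N = "nbh E i"
      have "card {R \<in> Pow V. bad i R}
          = card {X \<in> Pow ?N. card X \<le> c \<or> card ?N \<le> card X + c} * card {Y \<in> Pow (V - ?N). True}"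
        using card_Pow_split[OF finite_verts nbh_subset[of i], where Q = "\<lambda>_. True"
            and P = "\<lambda>X. card X \<le> c \<or> card ?N \<le> card X + c"] reg[OF i] by (simp add: bad_def)
      also have "card {Y \<in> Pow (V - ?N). True} = 2 ^ (card V - d)"
        using card_Pow[of "V - ?N"] finite_verts finite_nbh nbh_subset[of i] reg[OF i]
        by (simp add: Pow_def card_Diff_subset)
      also have "card {X \<in> Pow ?N. card X \<le> c \<or> card ?N \<le> card X + c} \<le> 2 * Q"
      proof -
        have "{X \<in> Pow ?N. card X \<le> c \<or> card ?N \<le> card X + c}
            = {X \<in> Pow ?N. card X \<le> c} \<union> {X \<in> Pow ?N. card ?N \<le> card X + c}" by auto
        then show ?thesis
          using card_Un_le[of "{X \<in> Pow ?N. card X \<le> c}" "{X \<in> Pow ?N. card ?N \<le> card X + c}"]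
            card_Pow_card_le[OF finite_nbh, of i c] card_Pow_card_ge[OF finite_nbh, of i c] reg[OF i]
          by (simp add: Q_def)
      qed
      finally have "card {R \<in> Pow V. bad i R} \<le> 2 * Q * 2 ^ (card V - d)" by simp
      then have "real (card {R \<in> Pow V. bad i R}) \<le> real (2 * Q * 2 ^ (card V - d))"
        by (simp only: of_nat_le_iff)
      then have le: "real (card {R \<in> Pow V. bad i R}) \<le> 2 * real Q * 2 ^ (card V - d)"
        by (simp only: of_nat_mult of_nat_power of_nat_numeral)
      have "d \<le> card V"
        using card_mono[OF finite_verts nbh_subset, of i] reg[OF i] by simp
      then have "(2 :: real) ^ (card V - d) = 2 ^ card V / 2 ^ d" by (simp add: power_diff)
      then show ?thesis using le by (simp only: times_divide_eq_left times_divide_eq_right)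
    qed
    have "D \<ge> 1" using d by (cases d) (auto simp: D_def)
    then show "1 / (real D + 1) < 1" by simp
    define K where "K = (real D + 1) * exp 1"
    have "K > 0" by (simp add: K_def add_nonneg_pos)
    moreover have "2 * real Q * K \<le> 2 ^ d"
      unfolding K_def Q_def D_def mult.assoc[symmetric] using bound by simp
    ultimately have "2 * real Q / 2 ^ d \<le> 1 / K" by (simp add: field_simps)
    also have "1 / K = 1 / (real D + 1) * exp (- 1)" by (simp add: K_def exp_minus divide_inverse)
    also have "\<dots> \<le> 1 / (real D + 1) * (1 - 1 / (real D + 1)) ^ D"
      by (intro mult_left_mono exp_one_power_bound) auto
    finally show "2 * real Q / 2 ^ d \<le> 1 / (real D + 1) * (1 - 1 / (real D + 1)) ^ D" .
  qed (use finite_verts nbh_subset in \<open>auto simp: bad_def\<close>)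
  then obtain R where R: "R \<subseteq> V" "\<And>v. v \<in> V \<Longrightarrow> \<not> bad v R" by blast
  have "c < card (nbh E v \<inter> R) \<and> card (nbh E v \<inter> R) + c < d" if "v \<in> V" for v
    using R(2)[OF that] unfolding bad_def Int_commute[of R] by linarith
  then show ?thesis using R(1) by blast
qed

text \<open>The bound \<open>exp 1 \<le> 3\<close> of the library is too weak for \<open>d = 14\<close> below.\<close>

lemma exp_1_le: "exp 1 \<le> (73 / 25 :: real)"
proof -
  \<comment> \<open>Inverting \<open>1 + y \<le> exp y\<close> at \<open>y = - 1 / 8\<close> and
    taking the eighth power gives \<open>(8 / 7) ^ 8\<close>, about 2.9103.\<close>
  have "7 / 8 \<le> exp (- (1 / 8) :: real)" using exp_ge_add_one_self[of "- (1 / 8) :: real"] by simp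
  then have "exp (1 / 8 :: real) \<le> 8 / 7" by (simp add: exp_minus field_simps)
  then have "exp (1 / 8 :: real) ^ 8 \<le> (8 / 7) ^ 8" by (intro power_mono) auto
  then show ?thesis by (simp add: power_divide flip: exp_of_nat_mult)
qed

text \<open>The polynomial factor collapses to \<open>2 * (d ^ 3 + 1)\<close>. The estimate holds
  narrowly at 14, and from there a step of \<open>d\<close> at most doubles the polynomial.\<close>

lemma lll_bound_even:
  assumes "14 \<le> d"
  shows "2 * real (\<Sum>i\<le>1. d choose i) * (real (d * (d - 1)) + 1) * exp 1 \<le> 2 ^ d"
proof -
  have sum: "2 * real (\<Sum>i\<le>1. d choose i) = 2 * (1 + real d)" by simp
  have "73 * (2 * (real d ^ 3 + 1)) \<le> 25 * 2 ^ d"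
    using assms
  proof (induction d rule: dec_induct)
    case (step n)
    have "14 * real n ^ 2 \<le> real n * real n ^ 2" "14 * real n \<le> real n ^ 2"
      using step.hyps by (auto simp: power2_eq_square intro!: mult_right_mono)
    then have "3 * real n ^ 2 + 3 * real n \<le> real n ^ 3"
      by (simp add: power3_eq_cube power2_eq_square)
    then have "real (Suc n) ^ 3 + 1 \<le> 2 * (real n ^ 3 + 1)"
      by (simp add: power3_eq_cube power2_eq_square algebra_simps)
    then show ?case using step.IH by simp
  qed simp
  moreover have "(1 + real d) * (real (d * (d - 1)) + 1) = real d ^ 3 + 1"
    using assms by (simp add: of_nat_diff power3_eq_cube algebra_simps)
  ultimately have "(2 * (1 + real d) * (real (d * (d - 1)) + 1)) * (73 / 25) \<le> 2 ^ d"
    by (simp add: field_simps)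
  moreover have "(2 * (1 + real d) * (real (d * (d - 1)) + 1)) * exp 1
      \<le> (2 * (1 + real d) * (real (d * (d - 1)) + 1)) * (73 / 25)"
    using exp_1_le by (intro mult_left_mono) auto
  ultimately show ?thesis unfolding sum by (rule order_trans[rotated])
qed

text \<open>Same scheme with the quartic \<open>d ^ 4 + 2 * d ^ 2 - d + 2\<close>; the inequality
  fails at 17 and 18.\<close>

lemma lll_bound_odd:
  assumes "19 \<le> d"
  shows "2 * real (\<Sum>i\<le>2. d choose i) * (real (d * (d - 1)) + 1) * exp 1 \<le> 2 ^ d"
proof -
  have "2 * (d choose 2) + d = d ^ 2"
    by (simp add: choose_two power2_eq_square) (cases d, auto)
  then have "real (2 * (d choose 2) + d) = real (d ^ 2)" by (simp only:)
  then have sum: "2 * real (\<Sum>i\<le>2. d choose i) = real d ^ 2 + real d + 2"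
    by (simp add: numeral_2_eq_2)
  have "73 * (real d ^ 4 + 2 * real d ^ 2 - real d + 2) \<le> 25 * 2 ^ d"
    using assms
  proof (induction d rule: dec_induct)
    case (step n)
    have "19 * real n ^ 3 \<le> real n ^ 4" "19 * real n ^ 2 \<le> real n ^ 3" "19 * real n \<le> real n ^ 2"
      using step.hyps by (auto simp: power2_eq_square power3_eq_cube power4_eq_xxxx intro!: mult_right_mono)
    moreover have "real (Suc n) ^ 4 = real n ^ 4 + 4 * real n ^ 3 + 6 * real n ^ 2 + 4 * real n + 1"
      "real (Suc n) ^ 2 = real n ^ 2 + 2 * real n + 1"
      by (simp_all add: power2_eq_square power3_eq_cube power4_eq_xxxx algebra_simps)
    ultimately have "real (Suc n) ^ 4 + 2 * real (Suc n) ^ 2 - real (Suc n) + 2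
        \<le> 2 * (real n ^ 4 + 2 * real n ^ 2 - real n + 2)"
      using step.hyps by simp
    then show ?case using step.IH by simp
  qed simp
  moreover have "(real d ^ 2 + real d + 2) * (real (d * (d - 1)) + 1)
      = real d ^ 4 + 2 * real d ^ 2 - real d + 2"
    using assms by (simp add: of_nat_diff power2_eq_square power4_eq_xxxx algebra_simps)
  ultimately have "((real d ^ 2 + real d + 2) * (real (d * (d - 1)) + 1)) * (73 / 25) \<le> 2 ^ d"
    by (simp add: field_simps)
  moreover have "((real d ^ 2 + real d + 2) * (real (d * (d - 1)) + 1)) * exp 1
      \<le> ((real d ^ 2 + real d + 2) * (real (d * (d - 1)) + 1)) * (73 / 25)"
    using exp_1_le by (intro mult_left_mono) auto
  ultimately show ?thesis unfolding sum by (rule order_trans[rotated])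
qed

section \<open>The decomposition\<close>

theorem theorem7:
  fixes d :: nat and V :: "'a set" and E :: "'a set set"
  assumes "d \<ge> 14" and "d \<noteq> 15" and "d \<noteq> 17"
    and "regular_graph d V E"
  shows "\<exists>F. graph_decomposition E 2 F \<and> (\<forall>i<2. fulfills_123 V (F i))"
proof -
  interpret simple_graph V E using assms(4) by (simp add: regular_graph_def)
  have reg: "card (nbh E v) = d" if "v \<in> V" for v
    using assms(4) that bij_betw_same_card[OF bij_betw_nbh[OF edge_card]]
    by (simp add: regular_graph_def)
  obtain c where c: "even d \<and> c = 1 \<or> c = 2"
    and bound: "2 * real (\<Sum>i\<le>c. d choose i) * (real (d * (d - 1)) + 1) * exp 1 \<le> 2 ^ d"
  proof (cases "even d")
    case True
    then show ?thesis using that[of 1] lll_bound_even[OF assms(1)] by simp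
  next
    case False
    then have "d \<noteq> 14" "d \<noteq> 16" "d \<noteq> 18" by auto
    then have "19 \<le> d" using assms(1-3) by linarith
    then show ?thesis using that[of 2] lll_bound_odd by simp
  qed
  obtain R where R: "R \<subseteq> V"
    and bal: "\<And>v. v \<in> V \<Longrightarrow> c < card (nbh E v \<inter> R) \<and> card (nbh E v \<inter> R) + c < d"
    using exists_balanced_bipartition[OF reg _ bound] assms(1) by auto
  define S where "S = V - R"
  \<comment> \<open>The balance condition is invariant under replacing a count \<open>n\<close> by
    \<open>d - n\<close>.\<close>
  have bal_S: "c < card (nbh E v \<inter> S) \<and> card (nbh E v \<inter> S) + c < d" if "v \<in> V" for v
  proof -
    have "nbh E v \<inter> S = nbh E v - nbh E v \<inter> R" using nbh_subset by (auto simp: S_def)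
    then have "card (nbh E v \<inter> S) = d - card (nbh E v \<inter> R)"
      using reg[OF that] finite_nbh by (simp add: card_Diff_subset)
    then show ?thesis using bal[OF that] by auto
  qed
  define A where "A = {(u, v). {u, v} \<in> E \<and> (u \<in> R \<longleftrightarrow> v \<notin> R)}"
  have AV: "u \<in> V \<and> v \<in> V" if "(u, v) \<in> A" for u v using that edge_subset by (auto simp: A_def)
  \<comment> \<open>Both halves see the same cut, so one balanced orientation serves them
    both.\<close>
  have A_S: "A = {(u, v). {u, v} \<in> E \<and> (u \<in> S \<longleftrightarrow> v \<notin> S)}"
    using edge_subset by (fastforce simp: A_def S_def)
  have "finite A" by (rule finite_subset[of A "V \<times> V"]) (use AV finite_verts in auto)
  moreover have "sym A" "irrefl A" by (auto simp: A_def sym_def irrefl_def insert_commute)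
  ultimately obtain D where D: "orients A D" "\<And>v. \<bar>excess D v\<bar> \<le> 1"
    using balanced_orientation by blast
  define half where "half U = {e \<in> E. e \<subseteq> U} \<union> (\<lambda>(u, h). {u, h}) ` (D \<inter> U \<times> (V - U))" for U
  have "fulfills_123 V (half R)"
    unfolding half_def
    by (rule fulfills_123_half_of_orientation[OF R reg bal c D(1)[unfolded A_def] D(2)])
  moreover have "fulfills_123 V (half S)"
    unfolding half_def
    by (rule fulfills_123_half_of_orientation[OF _ reg bal_S c D(1)[unfolded A_S] D(2)])
      (auto simp: S_def)
  moreover have "half R \<union> half S = E"
  proof
    show "half R \<union> half S \<subseteq> E" using D(1) by (auto simp: half_def orients_def A_def)
    show "E \<subseteq> half R \<union> half S"
    proof
      fix e assume e: "e \<in> E"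
      then obtain u v where uv: "e = {u, v}" "u \<noteq> v" using edge_card[of e] by (auto simp: card_2_iff)
      show "e \<in> half R \<union> half S"
      proof (cases "(u, v) \<in> A")
        case True
        then have "(u, v) \<in> D \<or> (v, u) \<in> D" using D(1) by (auto simp: orients_def)
        then show ?thesis
          using True AV[OF True] uv by (auto simp: half_def A_def S_def image_iff insert_commute)
      next
        case False
        then show ?thesis using e uv edge_subset[OF e] by (auto simp: half_def A_def S_def)
      qed
    qed
  qed
  \<comment> \<open>A cut edge belongs to the half containing its tail, and \<open>D\<close> has no
    opposite arcs; an edge inside one part cannot occur in the other half.\<close>
  moreover have "e \<notin> half S" if "e \<in> half R" for e
  proof
    assume S: "e \<in> half S"
    then have "e \<in> E" using \<open>half R \<union> half S = E\<close> by blast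
    then obtain u v where "e = {u, v}" using edge_card[of e] by (auto simp: card_2_iff)
    moreover have "(y, x) \<notin> D" if "(x, y) \<in> D" for x y using that D(1) by (auto simp: orients_def)
    ultimately show False
      using S \<open>e \<in> half R\<close> by (auto simp: half_def S_def doubleton_eq_iff)
  qed
  then have "half R \<inter> half S = {}" by blast
  ultimately show ?thesis
    by (intro exI[of _ "\<lambda>i. if i = 0 then half R else half S"])
      (auto simp: graph_decomposition_def disjoint_family_on_def lessThan_Suc numeral_2_eq_2 less_Suc_eq)
qed

end
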